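(* The following assertion is false: for all real $a<b$, all $q\in(0,1)$, every $q$-differentiable function $f:[a,b]\to\mathbb{R}$ with $D_q^a f$ continuous on $[a,b]$, and every $x\in[a,b]$, $$\left| f(x)-\frac{1}{b-a}\int_a^b f(t)\,d_q^a t\right| \le \left[\frac{2q}{1+q}\left(\frac{x-\frac{(3q-1)a+(1+q)b}{4q}}{b-a}\right)^2+\frac{-q^2+6q-1}{8q(1+q)}\right](b-a)\left\|D_q^a f\right\|_\infty.$$
   Context: Let $f:[a,b]\to\mathbb{R}$ and $q\in(0,1)$. The (shifted) $q$-derivative of $f$ at $x\in(a,b]$ is $$D_q^a f(x)=\frac{f(x)-f(a+q(x-a))}{(1-q)(x-a)}.$$ The function $f$ is called $q$-differentiable on $[a,b]$ if $\lim_{x\to a}D_q^a f(x)$ exists, and then $D_q^a f(a)$ is defined to be this limit. The (shifted) $q$-integral is $$\int_a^b f(t)\,d_q^a t=(1-q)(b-a)\sum_{k=0}^\infty q^k f\big(a+q^k(b-a)\big).$$ Also $\|D_q^a f\|_\infty=\sup_{t\in[a,b]}|D_q^a f(t)|$. *)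

theory Defs
  imports Complex_Main
begin

text \<open>A function on \<open>[a,b]\<close> is represented by a total function \<open>real \<Rightarrow> real\<close>; for \<open>0 < q < 1\<close> and
  \<open>a < b\<close> everything below depends only on its values on \<open>[a,b]\<close>.\<close>

definition qquot :: "real \<Rightarrow> real \<Rightarrow> (real \<Rightarrow> real) \<Rightarrow> real \<Rightarrow> real" where
  "qquot q a f x = (f x - f (a + q * (x - a))) / ((1 - q) * (x - a))"

definition q_differentiable_on :: "real \<Rightarrow> real \<Rightarrow> real \<Rightarrow> (real \<Rightarrow> real) \<Rightarrow> bool" where
  "q_differentiable_on q a b f \<longleftrightarrow> (\<exists>l. (qquot q a f \<longlongrightarrow> l) (at a within {a<..b}))"

text \<open>The value at \<open>x = a\<close> is only meaningful for \<open>q\<close>-differentiable functions. Since \<open>a < b\<close>, the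
  filters \<open>at_right a\<close> and \<open>at a within {a<..b}\<close> coincide.\<close>

definition qderiv :: "real \<Rightarrow> real \<Rightarrow> (real \<Rightarrow> real) \<Rightarrow> real \<Rightarrow> real" where
  "qderiv q a f x = (if x = a then Lim (at_right a) (qquot q a f) else qquot q a f x)"

text \<open>The series converges whenever \<open>f\<close> is \<open>q\<close>-differentiable on \<open>[a,b]\<close>, because then the values
  \<open>f (a + q ^ k * (b - a))\<close> converge as \<open>k\<close> grows.\<close>

definition qintegral :: "real \<Rightarrow> real \<Rightarrow> real \<Rightarrow> (real \<Rightarrow> real) \<Rightarrow> real" where
  "qintegral q a b f = (1 - q) * (b - a) * (\<Sum>k. q ^ k * f (a + q ^ k * (b - a)))"

definition sup_norm_on :: "real \<Rightarrow> real \<Rightarrow> (real \<Rightarrow> real) \<Rightarrow> real" where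
  "sup_norm_on a b g = (SUP t\<in>{a..b}. \<bar>g t\<bar>)"

end

(* The bound fails because f x is only weakly tied to the values of f at the points
   a + q^k (b - a), which determine the q-integral. For small q the integral is close to
   (b - a) f b, so a q-derivative changing sign between x and b pushes f x and the integral mean
   apart. Here a = 0, b = 1, q = 1/10, x = 1/2 and f t = 11 t - 20 t^2, whose q-derivative is
   11 - 22 t: the left-hand side is about 8.5 and the right-hand side is 5. *)
theory Submission
  imports Defs
begin

text \<open>For \<open>q = 1/10\<close> the \<open>q\<close>-derivative sends \<open>t\<close> to
  \<open>1\<close> and \<open>t\<^sup>2\<close> to \<open>(11/10) * t\<close>, so these coefficients
  give one with its zero at \<open>1/2\<close> and opposite values at \<open>0\<close> and
  \<open>1\<close>.\<close>

definition cex :: "real \<Rightarrow> real" where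
  "cex t = 11 * t - 20 * t\<^sup>2"

lemma qquot_cex: "t \<noteq> 0 \<Longrightarrow> qquot (1/10) 0 cex t = 11 - 22 * t"
  by (simp add: qquot_def cex_def field_simps power2_eq_square)

text \<open>The set \<open>S\<close> is left free to cover both \<open>at_right 0\<close> in
  \<open>qderiv\<close> and the filter in \<open>q_differentiable_on\<close>.\<close>

lemma tendsto_qquot_cex: "(qquot (1/10) 0 cex \<longlongrightarrow> 11) (at 0 within S)"
proof -
  have "((\<lambda>t::real. 11 - 22 * t) \<longlongrightarrow> 11 - 22 * 0) (at 0 within S)"
    by (intro tendsto_intros)
  moreover have "\<forall>\<^sub>F t in at 0 within S. 11 - 22 * t = qquot (1/10) 0 cex t"
    by (auto simp: eventually_at_filter qquot_cex)
  ultimately show ?thesis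
    by (auto intro: Lim_transform_eventually)
qed

lemma qderiv_cex: "qderiv (1/10) 0 cex = (\<lambda>t. 11 - 22 * t)"
proof
  fix t
  have "Lim (at_right 0) (qquot (1/10) 0 cex) = 11"
    by (rule tendsto_Lim[OF _ tendsto_qquot_cex]) simp
  then show "qderiv (1/10) 0 cex t = 11 - 22 * t"
    by (simp add: qderiv_def qquot_cex)
qed

lemma sup_norm_qderiv_cex: "sup_norm_on 0 1 (qderiv (1/10) 0 cex) = 11"
  unfolding sup_norm_on_def qderiv_cex
proof (rule cSup_eq_maximum)
  \<comment> \<open>The maximum is attained at the endpoint \<open>t = 0\<close>.\<close>
  show "(11::real) \<in> (\<lambda>t. \<bar>11 - 22 * t\<bar>) ` {0..1}"
    by (rule image_eqI[of _ _ 0]) auto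
qed (auto simp: abs_le_iff)

text \<open>The series splits into two geometric ones with ratios \<open>q\<^sup>2 = 1/100\<close>
  and \<open>q ^ 3 = 1/1000\<close>.\<close>

lemma qintegral_cex: "qintegral (1/10) 0 1 cex = - 890 / 111"
proof -
  have "(\<lambda>k. 11 * (1/100::real) ^ k - 20 * (1/1000) ^ k) sums
      (11 * (1 / (1 - 1/100)) - 20 * (1 / (1 - 1/1000)))"
    by (intro sums_diff sums_mult geometric_sums) auto
  moreover have "(\<lambda>k. (1/10::real) ^ k * cex (0 + (1/10) ^ k * (1 - 0)))
      = (\<lambda>k. 11 * (1/100) ^ k - 20 * (1/1000) ^ k)"
  proof
    fix k
    have "(1/100::real) ^ k = (1/10) ^ k * (1/10) ^ k"
      and "(1/1000::real) ^ k = (1/10) ^ k * ((1/10) ^ k * (1/10) ^ k)"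
      by (simp_all flip: power_mult_distrib)
    then show "(1/10::real) ^ k * cex (0 + (1/10) ^ k * (1 - 0))
        = 11 * (1/100) ^ k - 20 * (1/1000) ^ k"
      by (simp only: cex_def power2_eq_square) (simp add: algebra_simps)
  qed
  ultimately have "(\<Sum>k. (1/10::real) ^ k * cex (0 + (1/10) ^ k * (1 - 0)))
      = 11 * (1 / (1 - 1/100)) - 20 * (1 / (1 - 1/1000))"
    by (simp only: sums_iff)
  then show ?thesis
    unfolding qintegral_def by (simp only:) simp
qed

theorem mainTheorem8:
  "\<not> (\<forall>(a::real) (b::real) (q::real) (f::real \<Rightarrow> real) (x::real).
        a < b \<longrightarrow> 0 < q \<longrightarrow> q < 1 \<longrightarrow>
        q_differentiable_on q a b f \<longrightarrow> continuous_on {a..b} (qderiv q a f) \<longrightarrow>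
        x \<in> {a..b} \<longrightarrow>
        \<bar>f x - 1 / (b - a) * qintegral q a b f\<bar>
          \<le> (2 * q / (1 + q) * ((x - ((3 * q - 1) * a + (1 + q) * b) / (4 * q)) / (b - a))\<^sup>2
               + (- (q\<^sup>2) + 6 * q - 1) / (8 * q * (1 + q)))
             * (b - a) * sup_norm_on a b (qderiv q a f))"
    (is "\<not> (\<forall>a b q f x. ?P a b q f x)")
proof
  assume "\<forall>a b q f x. ?P a b q f x"
  then have "?P 0 1 (1/10) cex (1/2)"
    by blast
  moreover have "q_differentiable_on (1/10) 0 1 cex"
    unfolding q_differentiable_on_def using tendsto_qquot_cex by blast
  moreover have "continuous_on {0..1} (qderiv (1/10) 0 cex)"
    unfolding qderiv_cex by (intro continuous_intros)
  ultimately show False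
    unfolding sup_norm_qderiv_cex qintegral_cex
    \<comment> \<open>Since \<open>cex (1/2) = 1/2\<close>, the left side is
      \<open>1/2 + 890/111 = 1891/222\<close>; the bracket is \<open>5/11\<close>, so the right side
      is \<open>5\<close>.\<close>
    by (simp add: cex_def power2_eq_square)
qed

end
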